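(* Let $G$ be a group. Then $G$ admits an inverse ambiguous function if and only if either $G$ is infinite, or $G$ is finite and \[ |\{x\in G:\operatorname{ord}(x)\geq 3\}|\equiv 0\pmod 4 . \]
   Context: Let $G$ be a group. A bijection $f\colon G\to G$ is called an inverse ambiguous function if $f^{-1}(x)=f(x)^{-1}$ for every $x\in G$, where $f^{-1}(x)$ denotes the preimage of $x$ under $f$ and $f(x)^{-1}$ denotes the inverse of the element $f(x)$ in $G$. The function $f$ is not required to be a homomorphism. $\operatorname{ord}(x)$ denotes the order of the element $x$. *)

theory Defs
  imports "HOL-Algebra.Multiplicative_Group" "HOL-Number_Theory.Cong"
begin

text \<open>The preimage map is \<open>inv_into (carrier G) f\<close>; \<open>inv\<^bsub>G\<^esub>\<close> is inversion in the group.\<close>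

definition inverse_ambiguous :: "('a, 'b) monoid_scheme \<Rightarrow> ('a \<Rightarrow> 'a) \<Rightarrow> bool" where
  "inverse_ambiguous G f \<longleftrightarrow>
     bij_betw f (carrier G) (carrier G) \<and>
     (\<forall>x\<in>carrier G. inv_into (carrier G) f x = inv\<^bsub>G\<^esub> (f x))"

end

theory Submission
  imports Defs
begin

text \<open>
  A map \<open>f\<close> is inverse ambiguous iff \<open>f \<circ> f\<close> is inversion, so the question is when the
  involution \<open>x \<mapsto> x\<inverse>\<close> has a square root. The square of a permutation has a 2-cycle only where
  the permutation has a 4-cycle, which then splits into two of them; hence an involution has a square
  root iff the number of its 2-cycles is even or infinite. Finally, an infinite group
  has either no or infinitely many elements with \<open>x \<noteq> x\<inverse>\<close>.
\<close>

section \<open>Square roots of involutions on a set\<close>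

lemma infinite_halving:
  includes cardinal_syntax
  assumes "infinite T"
  obtains S S' h where "bij_betw h S S'" "S \<inter> S' = {}" "S \<union> S' = T"
proof -
  \<comment> \<open>Two disjoint copies of an infinite set are equipotent to the set itself; the
    images of the copies under \<open>p\<close> are the two halves.\<close>
  have "|T <+> T| =o |T|"
    using assms card_of_Plus_infinite1 card_of_refl ordIso_iff_ordLeq by blast
  then obtain p where p: "bij_betw p (T <+> T) T"
    using card_of_ordIso by blast
  have inj: "inj_on p (T <+> T)" and im: "p ` (T <+> T) = T"
    using p by (auto simp: bij_betw_def)
  have "bij_betw (p \<circ> Inl) T (p ` Inl ` T)" "bij_betw (p \<circ> Inr) T (p ` Inr ` T)"
    using inj by (auto simp: bij_betw_def inj_on_def)
  then obtain h where "bij_betw h (p ` Inl ` T) (p ` Inr ` T)"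
    by (meson bij_betw_inv bij_betw_trans)
  moreover have "p ` Inl ` T \<inter> p ` Inr ` T = {}"
    using inj by (auto simp: inj_on_def)
  moreover have "p ` Inl ` T \<union> p ` Inr ` T = T"
    using im by (simp add: Plus_def image_Un)
  ultimately show ?thesis by (rule that)
qed

lemma finite_even_halving:
  assumes "finite T" "even (card T)"
  obtains S S' h where "bij_betw h S S'" "S \<inter> S' = {}" "S \<union> S' = T"
proof -
  obtain S where S: "S \<subseteq> T" "card S = card T div 2"
    by (meson div_le_dividend obtain_subset_with_card_n)
  have "card (T - S) = card S"
    using S assms by (auto simp: card_Diff_subset finite_subset)
  then obtain h where "bij_betw h S (T - S)"
    using finite_same_card_bij S(1) assms(1) by (metis finite_Diff finite_subset)
  then show ?thesis
    using that[of h S "T - S"] S(1) by blast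
qed

lemma involution_transversal:
  assumes i: "\<And>x. x \<in> N \<Longrightarrow> i x \<in> N" "\<And>x. x \<in> N \<Longrightarrow> i (i x) = x" "\<And>x. x \<in> N \<Longrightarrow> i x \<noteq> x"
  obtains T where "T \<union> i ` T = N" "T \<inter> i ` T = {}"
proof -
  \<comment> \<open>The choice depends only on the set \<open>{x, i x}\<close>, so both points of a
    2-cycle get the same representative.\<close>
  define c where "c x = (SOME y. y \<in> {x, i x})" for x
  have c: "c x = x \<or> c x = i x" for x
    using someI[of "\<lambda>y. y \<in> {x, i x}" x] by (auto simp: c_def)
  have ci: "c (i x) = c x" if "x \<in> N" for x
    using i(2)[OF that] by (simp add: c_def insert_commute)
  define T where "T = {x \<in> N. c x = x}"
  have "T \<union> i ` T = N"
  proof (intro equalityI subsetI)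
    fix x assume "x \<in> N"
    then show "x \<in> T \<union> i ` T"
      using c[of x] ci[of x] i[of x] by (force simp: T_def image_iff)
  qed (auto simp: T_def i)
  moreover have "T \<inter> i ` T = {}"
    using ci i(3) by (force simp: T_def)
  ultimately show ?thesis by (rule that)
qed

text \<open>With \<open>T\<close> containing one point of each 2-cycle of \<open>i\<close> and
  \<open>h\<close> matching one half of \<open>T\<close> with the other, the cycles of
  \<open>s\<close> and \<open>h s\<close> are interleaved into the 4-cycle \<open>s\<close>,
  \<open>h s\<close>, \<open>i s\<close>, \<open>i (h s)\<close>, whose square is \<open>i\<close>
  there.\<close>

lemma involution_sqrt_exists:
  assumes i: "\<And>x. x \<in> A \<Longrightarrow> i x \<in> A" "\<And>x. x \<in> A \<Longrightarrow> i (i x) = x"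
    and card: "infinite {x \<in> A. i x \<noteq> x} \<or> 4 dvd card {x \<in> A. i x \<noteq> x}"
  obtains f where "\<And>x. x \<in> A \<Longrightarrow> f x \<in> A" "\<And>x. x \<in> A \<Longrightarrow> f (f x) = i x"
proof -
  define N where "N = {x \<in> A. i x \<noteq> x}"
  have N: "i x \<in> N" "i (i x) = x" "i x \<noteq> x" if "x \<in> N" for x
    using that i unfolding N_def by auto
  obtain T where T: "T \<union> i ` T = N" "T \<inter> i ` T = {}"
    using N involution_transversal[of N i] by metis
  have inj: "inj_on i N"
    using N(2) by (metis inj_onI)
  obtain S S' h where h: "bij_betw h S S'" "S \<inter> S' = {}" "S \<union> S' = T"
  proof (cases "finite T")
    case True
    have "card (i ` T) = card T"
      using inj T(1) by (meson card_image inj_on_subset sup_ge1)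
    then have "card N = 2 * card T"
      using True T by (metis card_Un_disjoint finite_imageI mult_2)
    moreover have "finite N" using True T(1) by blast
    ultimately have "even (card T)"
      using card unfolding N_def[symmetric] by auto
    with True show ?thesis using that by (metis finite_even_halving)
  qed (use that infinite_halving in metis)
  define k where "k = inv_into S h"
  have hk: "\<And>x. x \<in> S \<Longrightarrow> h x \<in> S'" "\<And>x. x \<in> S' \<Longrightarrow> k x \<in> S"
    "\<And>x. x \<in> S \<Longrightarrow> k (h x) = x" "\<And>x. x \<in> S' \<Longrightarrow> h (k x) = x"
    using h(1) unfolding k_def
    by (auto simp: bij_betw_def inv_into_into f_inv_into_f)
  \<comment> \<open>The branches treat the four points of a 4-cycle in order; the default keeps the
    fixed points of \<open>i\<close> fixed.\<close>
  define f where "f x = (if x \<in> S then h x else if x \<in> S' then i (k x)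
     else if i x \<in> S then i (h (i x)) else if i x \<in> S' then k (i x) else x)" for x
  have SN: "x \<in> N" "i x \<notin> S" "i x \<notin> S'" if "x \<in> S \<or> x \<in> S'" for x
    using that T h(3) by blast+
  have dis: "\<And>x. x \<in> S \<Longrightarrow> x \<notin> S'" "\<And>x. x \<in> S' \<Longrightarrow> x \<notin> S"
    using h(2) by auto
  have f: "f x = h x" "f (h x) = i x" "f (i x) = i (h x)" "f (i (h x)) = x" if "x \<in> S" for x
    using that hk[of x] hk(1)[OF that] SN[of x] SN[of "h x"] N(2)[of x] N(2)[of "h x"] dis
    by (auto simp: f_def)
  have cover: "\<exists>s\<in>S. x = s \<or> x = h s \<or> x = i s \<or> x = i (h s)" if "x \<in> N" for x
  proof -
    have "\<exists>s\<in>S. t = s \<or> t = h s" if "t \<in> T" for t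
      using that h(1,3) by (auto simp: bij_betw_def)
    with that T(1) show ?thesis by blast
  qed
  have NA: "N \<subseteq> A" by (auto simp: N_def)
  have mem: "s \<in> A" "h s \<in> A" "i s \<in> A" "i (h s) \<in> A" if "s \<in> S" for s
    using that hk(1) SN NA i(1) by blast+
  have "f x \<in> A \<and> f (f x) = i x" if x: "x \<in> A" for x
  proof (cases "x \<in> N")
    case True
    with cover obtain s where s: "s \<in> S" "x = s \<or> x = h s \<or> x = i s \<or> x = i (h s)" by blast
    then show ?thesis
      using f[OF s(1)] mem[OF s(1)] i(2)[OF mem(1)[OF s(1)]] i(2)[OF mem(2)[OF s(1)]] by auto
  next
    case False
    then have ix: "i x = x" using x by (simp add: N_def)
    then have "f x = x" using False SN(1) unfolding f_def by metis
    then show ?thesis using x ix by simp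
  qed
  then show ?thesis using that by blast
qed

text \<open>The fourth iterate of \<open>f\<close> is the identity on \<open>A\<close>, and the
  points moved by \<open>i\<close> split into \<open>f\<close>-orbits of exactly four
  elements.\<close>

lemma card_involution_with_sqrt:
  assumes fin: "finite A"
    and f: "\<And>x. x \<in> A \<Longrightarrow> f x \<in> A" "\<And>x. x \<in> A \<Longrightarrow> f (f x) = i x"
    and i: "\<And>x. x \<in> A \<Longrightarrow> i (i x) = x"
  shows "4 dvd card {x \<in> A. i x \<noteq> x}"
proof -
  define N where "N = {x \<in> A. i x \<noteq> x}"
  define orb where "orb x = {x, f x, f (f x), f (f (f x))}" for x
  have f4: "f (f (f (f x))) = x" if "x \<in> A" for x
    using that f i by metis
  have fN: "f x \<in> N" if "x \<in> N" for x
  proof -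
    from that have x: "x \<in> A" "i x \<noteq> x" by (auto simp: N_def)
    \<comment> \<open>If \<open>i\<close> fixed \<open>f x\<close>, applying \<open>f\<close> once
      more and cancelling the fourth iterate would give \<open>f (f x) = x\<close>, so
      \<open>i\<close> would fix \<open>x\<close>.\<close>
    have "i (f x) \<noteq> f x"
    proof
      assume "i (f x) = f x"
      then have "f (f (f x)) = f x" using f(2)[OF f(1)[OF x(1)]] by simp
      then have "f (f x) = x" using f4[OF x(1)] by simp
      with f x show False by simp
    qed
    with f(1)[OF x(1)] show ?thesis by (simp add: N_def)
  qed
  have neq: "f (f x) \<noteq> x" if "x \<in> N" for x
    using that f unfolding N_def by auto
  have NA: "x \<in> A" if "x \<in> N" for x using that by (simp add: N_def)
  have orb_f: "orb (f x) = orb x" if "x \<in> N" for x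
    using f4[OF NA[OF that]] by (auto simp: orb_def)
  have orb_eq: "orb y = orb x" if "x \<in> N" "y \<in> orb x" for x y
    using that fN orb_f unfolding orb_def by blast
  have "card (orb x) = 4" if "x \<in> N" for x
  proof -
    \<comment> \<open>Points two steps apart differ; if neighbours on the cycle coincided, applying
      \<open>f\<close> would make points two steps apart coincide as well.\<close>
    have d: "f (f x) \<noteq> x" "f (f (f x)) \<noteq> f x" "f (f (f (f x))) = x"
      using that fN neq f4 NA by auto
    then have "f x \<noteq> x" "f (f x) \<noteq> f x" "f (f (f x)) \<noteq> x" "f (f (f x)) \<noteq> f (f x)"
      by metis+
    with d show ?thesis by (auto simp: orb_def)
  qed
  moreover have "orb x \<inter> orb y = {}" if "x \<in> N" "y \<in> N" "orb x \<noteq> orb y" for x y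
    using that orb_eq by blast
  moreover have U: "\<Union> (orb ` N) = N"
    using fN by (auto simp: orb_def)
  moreover have "finite N" using fin by (simp add: N_def)
  ultimately have "4 * card (orb ` N) = card N"
    using card_partition[of "orb ` N" 4] by auto
  then have "4 dvd card N" by (rule dvdI[OF sym])
  then show ?thesis by (simp only: N_def)
qed

section \<open>Inversion as an involution on a group\<close>

context group
begin

lemma inv_eq_self_iff: "x \<in> carrier G \<Longrightarrow> inv x = x \<longleftrightarrow> x \<otimes> x = \<one>"
  by (metis inv_equality r_inv)

text \<open>Evaluating the preimage condition at \<open>f x\<close> gives
  \<open>x = inv (f (f x))\<close>. Conversely, \<open>f\<close> commutes with its square, hence
  with inversion, so \<open>x \<mapsto> inv (f x)\<close> is a two-sided inverse of
  \<open>f\<close>.\<close>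

lemma inverse_ambiguous_iff_sqrt:
  "inverse_ambiguous G f \<longleftrightarrow>
     (\<forall>x\<in>carrier G. f x \<in> carrier G \<and> f (f x) = inv x)"
proof
  assume "inverse_ambiguous G f"
  then have b: "bij_betw f (carrier G) (carrier G)"
    and e: "\<And>x. x \<in> carrier G \<Longrightarrow> inv_into (carrier G) f x = inv (f x)"
    by (auto simp: inverse_ambiguous_def)
  show "\<forall>x\<in>carrier G. f x \<in> carrier G \<and> f (f x) = inv x"
  proof
    fix x assume x: "x \<in> carrier G"
    then have fx: "f x \<in> carrier G" "f (f x) \<in> carrier G"
      using b by (auto simp: bij_betw_def)
    have "x = inv (f (f x))"
      using e[OF fx(1)] b x by (simp add: bij_betw_inv_into_left)
    then show "f x \<in> carrier G \<and> f (f x) = inv x"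
      using fx by (metis inv_inv)
  qed
next
  assume a: "\<forall>x\<in>carrier G. f x \<in> carrier G \<and> f (f x) = inv x"
  have comm: "f (inv x) = inv (f x)" if "x \<in> carrier G" for x
    using a that by metis
  have b: "bij_betw f (carrier G) (carrier G)"
    by (rule bij_betw_byWitness[where f' = "\<lambda>x. inv (f x)"]) (use a comm in \<open>auto\<close>)
  moreover have "inv_into (carrier G) f x = inv (f x)" if "x \<in> carrier G" for x
    using b a comm that
    by (intro inv_into_f_eq) (auto simp: bij_betw_def)
  ultimately show "inverse_ambiguous G f"
    by (simp add: inverse_ambiguous_def)
qed

text \<open>
  If there were only finitely many, then for infinitely many \<open>y\<close> we would have
  \<open>y\<^sup>2 = (x y)\<^sup>2 = 1\<close>, so that \<open>y\<close> inverts \<open>x\<close>. A product \<open>c = z y\<close> of two such elements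
  commutes with \<open>x\<close>; choosing \<open>y\<close> with \<open>c\<^sup>2 = (x c)\<^sup>2 = 1\<close> gives \<open>x\<^sup>2 = 1\<close>, a contradiction.
\<close>
lemma infinite_non_self_inverse:
  assumes inf: "infinite (carrier G)" and x: "x \<in> carrier G" "inv x \<noteq> x"
  shows "infinite {x \<in> carrier G. inv x \<noteq> x}"
proof
  define N where "N = {x \<in> carrier G. inv x \<noteq> x}"
  assume "finite {x \<in> carrier G. inv x \<noteq> x}"
  then have fin: "finite N" by (simp add: N_def)
  have translate: "finite {y \<in> carrier G. z \<otimes> y \<in> N}" if z: "z \<in> carrier G" for z
    by (rule inj_on_finite[of "\<lambda>y. z \<otimes> y", OF _ _ fin]) (use z in \<open>auto simp: inj_on_def\<close>)
  have self_inv: "y \<otimes> y = \<one>" if "y \<in> carrier G" "y \<notin> N" for y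
    using that inv_eq_self_iff by (auto simp: N_def)
  \<comment> \<open>Only finitely many elements are removed, as left translation is injective; for
    the remaining \<open>y\<close>, both \<open>y\<close> and \<open>x \<otimes> y\<close> are
    self-inverse.\<close>
  define Y where "Y = carrier G - (N \<union> {y \<in> carrier G. x \<otimes> y \<in> N})"
  have "infinite Y"
    using inf fin translate[OF x(1)] unfolding Y_def by (metis Diff_infinite_finite finite_UnI)
  then obtain z where z: "z \<in> Y" using infinite_imp_nonempty by blast
  have Y: "y \<in> carrier G" "y \<otimes> x = inv x \<otimes> y" "y \<otimes> inv x = x \<otimes> y" if "y \<in> Y" for y
  proof -
    from that have y: "y \<in> carrier G" "y \<otimes> y = \<one>" "(x \<otimes> y) \<otimes> (x \<otimes> y) = \<one>"
      using self_inv x(1) by (auto simp: Y_def)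
    then have iy: "inv y = y" "inv (x \<otimes> y) = x \<otimes> y"
      using x(1) inv_eq_self_iff by auto
    then show "y \<otimes> inv x = x \<otimes> y"
      using inv_mult_group[OF x(1) y(1)] by simp
    \<comment> \<open>The relation \<open>(x \<otimes> y) \<otimes> (x \<otimes> y) = \<one>\<close>
      makes \<open>x \<otimes> (y \<otimes> x)\<close> the inverse of \<open>y\<close>, which is
      \<open>y\<close>.\<close>
    have "x \<otimes> (y \<otimes> x) = y"
      using y x(1) iy(1) by (metis inv_equality m_assoc m_closed)
    then show "y \<otimes> x = inv x \<otimes> y"
      using x(1) y(1) by (metis inv_solve_left m_closed)
    show "y \<in> carrier G" by fact
  qed
  have zc: "z \<in> carrier G" using Y z by blast
  \<comment> \<open>With \<open>z\<close> fixed, these are the finitely many \<open>y\<close> for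
    which \<open>z \<otimes> y\<close> or its product with \<open>x\<close> fails to be
    self-inverse.\<close>
  define B where "B = {y \<in> carrier G. z \<otimes> y \<in> N} \<union> {y \<in> carrier G. (x \<otimes> z) \<otimes> y \<in> N}"
  have "finite B" using translate zc x(1) by (simp add: B_def)
  with \<open>infinite Y\<close> obtain y where y: "y \<in> Y" "y \<notin> B"
    by (meson finite_subset subsetI)
  define c where "c = z \<otimes> y"
  have yc: "y \<in> carrier G" and c: "c \<in> carrier G" using Y y zc by (auto simp: c_def)
  have cx: "c \<otimes> x = x \<otimes> c"
  proof -
    have "c \<otimes> x = z \<otimes> (inv x \<otimes> y)"
      using Y(2)[OF y(1)] zc yc x(1) by (simp add: c_def m_assoc)
    also have "\<dots> = (z \<otimes> inv x) \<otimes> y" using zc yc x(1) by (simp add: m_assoc)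
    also have "\<dots> = x \<otimes> c"
      using Y(3)[OF z] zc yc x(1) by (simp add: c_def m_assoc)
    finally show ?thesis .
  qed
  have "c \<otimes> c = \<one>" "(x \<otimes> c) \<otimes> (x \<otimes> c) = \<one>"
    using y(2) yc zc x(1) c self_inv[of c] self_inv[of "x \<otimes> c"]
    by (auto simp: B_def c_def m_assoc)
  moreover have "(x \<otimes> c) \<otimes> (x \<otimes> c) = (x \<otimes> x) \<otimes> (c \<otimes> c)"
    using cx x(1) c by (metis m_assoc m_closed)
  ultimately have "x \<otimes> x = \<one>" using x(1) by simp
  with x show False using inv_eq_self_iff by blast
qed

text \<open>Self-inverse means \<open>ord x dvd 2\<close>. Elements of infinite order have
  \<open>ord x = 0\<close>; finiteness rules them out.\<close>

lemma ord_ge_3_iff: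
  assumes "finite (carrier G)" "x \<in> carrier G"
  shows "ord x \<ge> 3 \<longleftrightarrow> inv x \<noteq> x"
proof -
  have "inv x = x \<longleftrightarrow> x [^] (2::nat) = \<one>"
    using assms(2) inv_eq_self_iff by (simp add: numeral_2_eq_2)
  also have "\<dots> \<longleftrightarrow> ord x dvd 2" using assms(2) by (rule pow_eq_id)
  also have "\<dots> \<longleftrightarrow> ord x < 3"
  proof
    assume "ord x < 3"
    moreover have "ord x \<ge> 1" using assms by (rule ord_ge_1)
    ultimately have "ord x = 1 \<or> ord x = 2" by auto
    then show "ord x dvd 2" by auto
  next
    assume "ord x dvd 2"
    then have "ord x \<le> 2" by (rule dvd_imp_le) simp
    then show "ord x < 3" by simp
  qed
  finally show ?thesis by auto
qed

end

theorem corollary3p3: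
  fixes G :: "('a, 'b) monoid_scheme"
  assumes "group G"
  shows "(\<exists>f. inverse_ambiguous G f) \<longleftrightarrow>
    (infinite (carrier G) \<or>
     (finite (carrier G) \<and> [card {x \<in> carrier G. group.ord G x \<ge> 3} = 0] (mod 4)))"
proof -
  interpret group G by fact
  define N where "N = {x \<in> carrier G. inv\<^bsub>G\<^esub> x \<noteq> x}"
  have ordN: "{x \<in> carrier G. ord x \<ge> 3} = N" if "finite (carrier G)"
    using ord_ge_3_iff[OF that] by (auto simp: N_def)
  show ?thesis
  proof
    assume "\<exists>f. inverse_ambiguous G f"
    then obtain f where f: "\<And>x. x \<in> carrier G \<Longrightarrow> f x \<in> carrier G"
      "\<And>x. x \<in> carrier G \<Longrightarrow> f (f x) = inv\<^bsub>G\<^esub> x"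
      by (auto simp: inverse_ambiguous_iff_sqrt)
    have "4 dvd card N" if "finite (carrier G)"
      unfolding N_def using that f by (rule card_involution_with_sqrt) auto
    then show "infinite (carrier G) \<or>
        (finite (carrier G) \<and> [card {x \<in> carrier G. ord x \<ge> 3} = 0] (mod 4))"
      using ordN by (auto simp: cong_0_iff)
  next
    assume a: "infinite (carrier G) \<or>
        (finite (carrier G) \<and> [card {x \<in> carrier G. ord x \<ge> 3} = 0] (mod 4))"
    have "infinite N \<or> 4 dvd card N"
    proof (cases "finite (carrier G)")
      case True
      then show ?thesis using a ordN by (auto simp: cong_0_iff)
    next
      case False
      then have "infinite N" if "N \<noteq> {}"
        using that infinite_non_self_inverse unfolding N_def by blast
      \<comment> \<open>In an infinite group where every element is self-inverse, \<open>N\<close>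
        is empty and 4 divides its cardinality 0.\<close>
      then show ?thesis by (cases "N = {}") auto
    qed
    then obtain f where "\<And>x. x \<in> carrier G \<Longrightarrow> f x \<in> carrier G"
      "\<And>x. x \<in> carrier G \<Longrightarrow> f (f x) = inv\<^bsub>G\<^esub> x"
      unfolding N_def by (rule involution_sqrt_exists[rotated 2]) auto
    then show "\<exists>f. inverse_ambiguous G f"
      using inverse_ambiguous_iff_sqrt by blast
  qed
qed

end
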